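(* Let $X\subseteq\mathbb{R}$, with the subspace topology, be such that disjoint closed subsets of $X$ can be separated by clopen subsets of $X$. Then $X$ satisfies $\mathsf{S}_1(C_\Gamma,C_\Gamma)$ if, and only if, for each continuous $\phi:X\to Fr^{\mathbb{N}}$ there is $f\in\mathbb{N}^{\mathbb{N}}$ such that, for each $x\in X$, $f(k)\in\phi(x)(k)$ for all but finitely many $k$.
   Context: $P(\mathbb{N})$ denotes the power set of $\mathbb{N}$, topologized by identifying it with the Cantor space $\{0,1\}^{\mathbb{N}}$. $Fr\subseteq P(\mathbb{N})$ is the Fréchet filter, i.e. the set of all cofinite subsets of $\mathbb{N}$, with the subspace topology; $Fr^{\mathbb{N}}$ carries the product topology. A family $\mathcal{U}=\{U_n:n\in\mathbb{N}\}$ of subsets of $X$ (taken together with its enumeration) is a $\gamma$-cover of $X$ if for each $x\in X$, $x\in U_n$ for all but finitely many $n$. $C_\Gamma$ is the collection of all $\gamma$-covers of $X$ by clopen subsets of $X$. For collections $\mathcal{A},\mathcal{B}$ of families of subsets of $X$, $\mathsf{S}_1(\mathcal{A},\mathcal{B})$ is the property: for each sequence $\{\mathcal{U}_n\}_{n\in\mathbb{N}}$ of members of $\mathcal{A}$ there exist members $U_n\in\mathcal{U}_n$, $n\in\mathbb{N}$, such that $\{U_n:n\in\mathbb{N}\}\in\mathcal{B}$. *)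

theory Defs
  imports "HOL-Analysis.Analysis"
begin

(* A family taken together with its enumeration is a sequence of sets, so repetitions are allowed
   and "all but finitely many n" refers to indices rather than to distinct members. *)

definition gamma_cover :: "'a set \<Rightarrow> (nat \<Rightarrow> 'a set) \<Rightarrow> bool" where
  "gamma_cover X U \<longleftrightarrow> (\<forall>n. U n \<subseteq> X) \<and> (\<forall>x\<in>X. \<forall>\<^sub>\<infinity>n. x \<in> U n)"

definition clopenin :: "'a topology \<Rightarrow> 'a set \<Rightarrow> bool" where
  "clopenin T C \<longleftrightarrow> openin T C \<and> closedin T C"

definition C_Gamma :: "'a topology \<Rightarrow> (nat \<Rightarrow> 'a set) set" where
  "C_Gamma T = {U. gamma_cover (topspace T) U \<and> (\<forall>n. clopenin T (U n))}"

(* The selected sets V n carry the enumeration of the given sequence of families. *)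

definition S1 :: "(nat \<Rightarrow> 'a set) set \<Rightarrow> (nat \<Rightarrow> 'a set) set \<Rightarrow> bool" where
  "S1 \<A> \<B> \<longleftrightarrow>
    (\<forall>\<U> :: nat \<Rightarrow> nat \<Rightarrow> 'a set. (\<forall>n. \<U> n \<in> \<A>) \<longrightarrow>
      (\<exists>V. (\<forall>n. V n \<in> range (\<U> n)) \<and> V \<in> \<B>))"

definition clopen_separated :: "'a topology \<Rightarrow> bool" where
  "clopen_separated T \<longleftrightarrow>
    (\<forall>A B. closedin T A \<and> closedin T B \<and> disjnt A B \<longrightarrow>
      (\<exists>C. clopenin T C \<and> A \<subseteq> C \<and> disjnt B C))"

(* Sets are identified with characteristic functions; euclidean on nat \<Rightarrow> bool is the product
   of the discrete topologies. *)

definition powerset_topology :: "nat set topology" where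
  "powerset_topology = pullback_topology UNIV (\<lambda>A n. n \<in> A) (euclidean :: (nat \<Rightarrow> bool) topology)"

definition Fr :: "nat set set" where
  "Fr = {A. finite (- A)}"

definition Fr_topology :: "nat set topology" where
  "Fr_topology = subtopology powerset_topology Fr"

definition Fr_power_topology :: "(nat \<Rightarrow> nat set) topology" where
  "Fr_power_topology = product_topology (\<lambda>_. Fr_topology) UNIV"

lemma topspace_Fr_power_topology: "topspace Fr_power_topology = {\<psi>. \<forall>k. \<psi> k \<in> Fr}"
  by (auto simp: Fr_power_topology_def Fr_topology_def powerset_topology_def
      topspace_pullback_topology PiE_def)

end

theory Submission
  imports Defs
begin

text \<open>
  A point of \<open>Fr\<^sup>\<nat>\<close> is a matrix of truth values, indexed by \<open>k\<close> and \<open>n\<close>, each of whose rows is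
  eventually true. Reading a map \<open>\<phi>\<close> from \<open>X\<close> to such matrices by entries instead of by points,
  one gets the sets \<open>U k n\<close> of those \<open>x\<close> with \<open>n \<in> \<phi> x k\<close>. Since the topology is that of pointwise
  convergence of truth values, \<open>\<phi>\<close> is continuous if and only if every \<open>U k n\<close> is clopen, and the
  rows are cofinite if and only if every sequence \<open>U k\<close> is a \<open>\<gamma>\<close>-cover. So the continuous maps
  into \<open>Fr\<^sup>\<nat>\<close> are the same thing as sequences of clopen \<open>\<gamma>\<close>-covers
  (\<open>continuous_map_Fr_power_iff_C_Gamma\<close>), and the correspondence is onto because each sequence
  \<open>\<U>\<close> of subsets is recovered from its matrix of membership values.

  Choosing one member \<open>U k (f k)\<close> from each cover is choosing a function \<open>f\<close>, and the chosen sets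
  form a \<open>\<gamma>\<close>-cover exactly when, for each \<open>x\<close>, \<open>f k \<in> \<phi> x k\<close> for all but finitely many \<open>k\<close>. The
  two sides of the equivalence are therefore translations of each other, over any topological space.
\<close>

lemma continuous_map_bool_iff_clopenin:
  "continuous_map T (euclidean :: bool topology) P \<longleftrightarrow> clopenin T {x \<in> topspace T. P x}"
proof
  assume P: "continuous_map T euclidean P"
  have "openin T {x \<in> topspace T. P x \<in> {True}}" "closedin T {x \<in> topspace T. P x \<in> {True}}"
    using P by (intro openin_continuous_map_preimage[OF P] closedin_continuous_map_preimage[OF P];
        simp add: open_discrete)+
  then show "clopenin T {x \<in> topspace T. P x}"
    by (simp add: clopenin_def)
next
  assume C: "clopenin T {x \<in> topspace T. P x}"
  have "openin T (topspace T - {x \<in> topspace T. P x})"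
    using C by (simp add: clopenin_def closedin_def)
  moreover have "topspace T - {x \<in> topspace T. P x} = {x \<in> topspace T. \<not> P x}"
    by blast
  ultimately have *: "openin T {x \<in> topspace T. P x}" "openin T {x \<in> topspace T. \<not> P x}"
    using C by (simp_all add: clopenin_def)
  have "openin T {x \<in> topspace T. P x \<in> B}" for B
  proof -
    have "P x \<in> B \<longleftrightarrow> P x \<and> True \<in> B \<or> \<not> P x \<and> False \<in> B" for x
      by (cases "P x") simp_all
    then have "{x \<in> topspace T. P x \<in> B} =
        (if True \<in> B then {x \<in> topspace T. P x} else {}) \<union>
        (if False \<in> B then {x \<in> topspace T. \<not> P x} else {})"
      by auto
    then show ?thesis
      using * by auto
  qed
  then show "continuous_map T euclidean P"
    by (simp add: continuous_map_def)
qed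

lemma continuous_map_powerset_topology_iff_clopenin:
  "continuous_map T powerset_topology \<psi> \<longleftrightarrow> (\<forall>n. clopenin T {x \<in> topspace T. n \<in> \<psi> x})"
proof -
  have "continuous_map T powerset_topology \<psi> \<longleftrightarrow>
      continuous_map T (euclidean :: (nat \<Rightarrow> bool) topology) (\<lambda>x n. n \<in> \<psi> x)"
    (is "?L \<longleftrightarrow> ?R")
  proof
    assume L: ?L
    show ?R
      using continuous_map_compose[OF L]
        continuous_map_pullback[of euclidean euclidean id UNIV "\<lambda>A n. n \<in> A"]
      by (simp add: powerset_topology_def o_def id_def)
  next
    assume ?R
    then show ?L
      unfolding powerset_topology_def
      by (intro continuous_map_pullback') (simp_all add: o_def)
  qed
  also have "\<dots> \<longleftrightarrow> (\<forall>n. continuous_map T euclidean (\<lambda>x. n \<in> \<psi> x))"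
    by (simp add: euclidean_product_topology[symmetric] continuous_map_componentwise_UNIV)
  finally show ?thesis
    by (simp add: continuous_map_bool_iff_clopenin)
qed

text \<open>
  The exchange of points and entries: clopenness of the entries is continuity, and cofiniteness of
  the rows, which is membership in \<open>Fr\<close>, is the covering condition.
\<close>

lemma continuous_map_Fr_power_iff_C_Gamma:
  "continuous_map T Fr_power_topology \<phi> \<longleftrightarrow>
    (\<forall>k. (\<lambda>n. {x \<in> topspace T. n \<in> \<phi> x k}) \<in> C_Gamma T)"
proof -
  have "continuous_map T Fr_topology \<psi> \<longleftrightarrow> (\<lambda>n. {x \<in> topspace T. n \<in> \<psi> x}) \<in> C_Gamma T" for \<psi>
    by (auto simp: Fr_topology_def continuous_map_in_subtopology
        continuous_map_powerset_topology_iff_clopenin C_Gamma_def gamma_cover_def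
        Fr_def eventually_cofinite Compl_eq)
  then show ?thesis
    by (simp add: Fr_power_topology_def continuous_map_componentwise_UNIV)
qed

text \<open>
  A selection principle chooses sets whereas \<open>f\<close> chooses indices. A set may occur several times in
  its cover, but any of its indices serves, since only the membership of \<open>x\<close> in the chosen set
  enters the covering condition.
\<close>

lemma S1_C_Gamma_iff_eventual_selection:
  fixes T :: "'a topology"
  shows "S1 (C_Gamma T) (C_Gamma T) \<longleftrightarrow>
    (\<forall>\<phi>. continuous_map T Fr_power_topology \<phi> \<longrightarrow>
      (\<exists>f :: nat \<Rightarrow> nat. \<forall>x\<in>topspace T. \<forall>\<^sub>\<infinity>k. f k \<in> \<phi> x k))"
proof
  assume S1: "S1 (C_Gamma T) (C_Gamma T)"
  show "\<forall>\<phi>. continuous_map T Fr_power_topology \<phi> \<longrightarrow>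
      (\<exists>f :: nat \<Rightarrow> nat. \<forall>x\<in>topspace T. \<forall>\<^sub>\<infinity>k. f k \<in> \<phi> x k)"
  proof (intro allI impI)
    fix \<phi> assume \<phi>: "continuous_map T Fr_power_topology \<phi>"
    define U where "U k n = {x \<in> topspace T. n \<in> \<phi> x k}" for k n
    have "\<forall>k. U k \<in> C_Gamma T"
      using \<phi> by (simp add: continuous_map_Fr_power_iff_C_Gamma U_def[abs_def])
    then obtain V where V: "\<forall>k. V k \<in> range (U k)" "V \<in> C_Gamma T"
      using S1[unfolded S1_def, rule_format, of U] by auto
    obtain f where f: "\<And>k. V k = U k (f k)"
      using V(1) unfolding image_iff by metis
    have "\<forall>\<^sub>\<infinity>k. f k \<in> \<phi> x k" if "x \<in> topspace T" for x
      using V(2) that by (simp add: C_Gamma_def gamma_cover_def f U_def)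
    then show "\<exists>f :: nat \<Rightarrow> nat. \<forall>x\<in>topspace T. \<forall>\<^sub>\<infinity>k. f k \<in> \<phi> x k"
      by blast
  qed
next
  assume sel: "\<forall>\<phi>. continuous_map T Fr_power_topology \<phi> \<longrightarrow>
      (\<exists>f :: nat \<Rightarrow> nat. \<forall>x\<in>topspace T. \<forall>\<^sub>\<infinity>k. f k \<in> \<phi> x k)"
  show "S1 (C_Gamma T) (C_Gamma T)"
    unfolding S1_def
  proof (intro allI impI)
    fix \<U> :: "nat \<Rightarrow> nat \<Rightarrow> 'a set"
    assume \<U>: "\<forall>k. \<U> k \<in> C_Gamma T"
    define \<phi> where "\<phi> x k = {n. x \<in> \<U> k n}" for x k
    have "(\<lambda>n. {x \<in> topspace T. n \<in> \<phi> x k}) = \<U> k" for k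
    proof -
      have "\<U> k n \<subseteq> topspace T" for n
        using \<U> by (simp add: C_Gamma_def gamma_cover_def)
      then show ?thesis
        by (auto simp: \<phi>_def)
    qed
    then have "continuous_map T Fr_power_topology \<phi>"
      using \<U> by (simp add: continuous_map_Fr_power_iff_C_Gamma)
    then obtain f where "\<forall>x\<in>topspace T. \<forall>\<^sub>\<infinity>k. f k \<in> \<phi> x k"
      using sel[rule_format, of \<phi>] by auto
    then have f: "\<forall>x\<in>topspace T. \<forall>\<^sub>\<infinity>k. x \<in> \<U> k (f k)"
      by (simp add: \<phi>_def)
    have "(\<lambda>k. \<U> k (f k)) \<in> C_Gamma T"
      using \<U> f by (simp add: C_Gamma_def gamma_cover_def)
    then show "\<exists>V. (\<forall>k. V k \<in> range (\<U> k)) \<and> V \<in> C_Gamma T"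
      by (intro exI[of _ "\<lambda>k. \<U> k (f k)"]) simp
  qed
qed

theorem theorem18:
  fixes X :: "real set"
  assumes "clopen_separated (top_of_set X)"
  shows "S1 (C_Gamma (top_of_set X)) (C_Gamma (top_of_set X)) \<longleftrightarrow>
    (\<forall>\<phi>. continuous_map (top_of_set X) Fr_power_topology \<phi> \<longrightarrow>
      (\<exists>f :: nat \<Rightarrow> nat. \<forall>x\<in>X. \<forall>\<^sub>\<infinity>k. f k \<in> \<phi> x k))"
  using S1_C_Gamma_iff_eventual_selection[of "top_of_set X"] by simp

end
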